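(* Let $k\ge2$, let ${\bf a}$ be a $k$-automatic sequence over a finite totally ordered alphabet $\Delta$, and let ${\bf b}$ be the lexicographically least sequence in the orbit closure of ${\bf a}$. Then ${\bf b}$ is $k$-automatic.
   Context: A sequence $(a_n)_{n\ge0}$ over $\Delta$ is $k$-automatic if there is a deterministic finite automaton with output $M=(Q,\{0,\ldots,k-1\},\Delta,\delta,q_0,\tau)$ such that $a_n=\tau(\delta(q_0,w^R))$ for every base-$k$ representation $w$ of $n$ (leading zeros allowed), $w^R$ being the reversal of $w$. The orbit closure of ${\bf a}$ is the closure (in the product topology) of the set of shifts $\{(a_{n+i})_{n\ge0}:i\ge0\}$; equivalently it is the set of sequences all of whose finite prefixes are factors of ${\bf a}$. Sequences are ordered lexicographically according to the order on $\Delta$. *)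

theory Defs
  imports "HOL-Analysis.Analysis" "HOL-Library.Fun_Lexorder"
begin

record ('q, 'd) dfao =
  states :: "'q set"
  initial :: 'q
  delta :: "'q \<Rightarrow> nat \<Rightarrow> 'q"
  tau :: "'q \<Rightarrow> 'd"

definition is_dfao :: "nat \<Rightarrow> 'd set \<Rightarrow> ('q, 'd) dfao \<Rightarrow> bool" where
  "is_dfao k \<Delta> M \<longleftrightarrow>
     finite (states M) \<and> initial M \<in> states M \<and>
     (\<forall>q\<in>states M. \<forall>d<k. delta M q d \<in> states M) \<and>
     (\<forall>q\<in>states M. tau M q \<in> \<Delta>)"

text \<open>Words are written with the most significant digit first; leading zeros are allowed and the
  empty word represents 0.\<close>

definition base_rep :: "nat \<Rightarrow> nat list \<Rightarrow> nat \<Rightarrow> bool" where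
  "base_rep k w n \<longleftrightarrow> set w \<subseteq> {..<k} \<and> foldl (\<lambda>v d. k * v + d) 0 w = n"

definition generates :: "nat \<Rightarrow> ('q, 'd) dfao \<Rightarrow> (nat \<Rightarrow> 'd) \<Rightarrow> bool" where
  "generates k M a \<longleftrightarrow>
     (\<forall>n w. base_rep k w n \<longrightarrow> a n = tau M (foldl (delta M) (initial M) (rev w)))"

text \<open>A definition cannot quantify over the type of states, so states are taken to be natural
  numbers; by \<open>automatic_if_dfao\<close> below this is no restriction.\<close>

definition automatic :: "nat \<Rightarrow> 'd set \<Rightarrow> (nat \<Rightarrow> 'd) \<Rightarrow> bool" where
  "automatic k \<Delta> a \<longleftrightarrow>
     range a \<subseteq> \<Delta> \<and> (\<exists>M :: (nat, 'd) dfao. is_dfao k \<Delta> M \<and> generates k M a)"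

definition orbit_closure :: "'d set \<Rightarrow> (nat \<Rightarrow> 'd) \<Rightarrow> (nat \<Rightarrow> 'd) set" where
  "orbit_closure \<Delta> a =
     product_topology (\<lambda>_. discrete_topology \<Delta>) UNIV closure_of range (\<lambda>i n. a (n + i))"

definition lex_least :: "(nat \<Rightarrow> 'd::linorder) set \<Rightarrow> (nat \<Rightarrow> 'd) \<Rightarrow> bool" where
  "lex_least S b \<longleftrightarrow> b \<in> S \<and> (\<forall>c\<in>S. b = c \<or> less_fun b c)"

lemma automatic_if_dfao:
  fixes M :: "('q, 'd) dfao"
  assumes "range a \<subseteq> \<Delta>" and M: "is_dfao k \<Delta> M" and gen: "generates k M a"
  shows "automatic k \<Delta> a"
proof -
  have "finite (states M)" using M by (simp add: is_dfao_def)
  then obtain f :: "'q \<Rightarrow> nat" where f: "inj_on f (states M)"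
    using finite_imp_inj_to_nat_seg by blast
  define g where "g = inv_into (states M) f"
  have gf: "g (f q) = q" if "q \<in> states M" for q
    using that f by (simp add: g_def)
  define N where "N = \<lparr>states = f ` states M, initial = f (initial M),
      delta = (\<lambda>q d. f (delta M (g q) d)), tau = (\<lambda>q. tau M (g q))\<rparr>"
  have "is_dfao k \<Delta> N"
    using M by (auto simp: is_dfao_def N_def gf)
  moreover have run: "foldl (delta M) q w \<in> states M \<and>
      foldl (delta N) (f q) w = f (foldl (delta M) q w)"
    if "q \<in> states M" "set w \<subseteq> {..<k}" for q w
    using that
  proof (induction w arbitrary: q)
    case (Cons d w)
    then have "delta M q d \<in> states M" using M by (auto simp: is_dfao_def)
    with Cons show ?case by (simp add: N_def gf)
  qed simp
  have "generates k N a"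
    unfolding generates_def
  proof (intro allI impI)
    fix n w assume w: "base_rep k w n"
    then have "set (rev w) \<subseteq> {..<k}" by (simp add: base_rep_def)
    moreover have "initial M \<in> states M" using M by (simp add: is_dfao_def)
    ultimately have r: "foldl (delta M) (initial M) (rev w) \<in> states M"
        "foldl (delta N) (f (initial M)) (rev w) = f (foldl (delta M) (initial M) (rev w))"
      using run by blast+
    have "a n = tau M (foldl (delta M) (initial M) (rev w))"
      using gen w by (simp add: generates_def)
    also have "\<dots> = tau N (f (foldl (delta M) (initial M) (rev w)))"
      using r(1) by (simp add: N_def gf)
    also have "\<dots> = tau N (foldl (delta N) (initial N) (rev w))"
      unfolding r(2)[symmetric] by (simp add: N_def)
    finally show "a n = tau N (foldl (delta N) (initial N) (rev w))" .
  qed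
  ultimately show ?thesis using assms(1) unfolding automatic_def by blast
qed

lemma orbit_closure_iff_prefixes:
  assumes "range a \<subseteq> \<Delta>"
  shows "b \<in> orbit_closure \<Delta> a \<longleftrightarrow> (\<forall>m. \<exists>i. \<forall>n<m. b n = a (n + i))"
proof
  assume b: "b \<in> orbit_closure \<Delta> a"
  show "\<forall>m. \<exists>i. \<forall>n<m. b n = a (n + i)"
  proof
    fix m
    let ?T = "product_topology (\<lambda>_. discrete_topology \<Delta>) (UNIV :: nat set)"
    let ?U = "PiE UNIV (\<lambda>n. if n < m then {b n} else \<Delta>)"
    have b\<Delta>: "b n \<in> \<Delta>" for n
      using b by (auto simp: orbit_closure_def closure_of_def PiE_iff)
    have "finite {n. (if n < m then {b n} else \<Delta>) \<noteq> \<Delta>}"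
      by (rule finite_subset[of _ "{..<m}"]) auto
    then have "openin ?T ?U"
      using b\<Delta> by (subst openin_PiE_gen) auto
    moreover have "b \<in> ?U" using b\<Delta> by auto
    ultimately obtain i where i: "(\<lambda>n. a (n + i)) \<in> ?U"
      using b unfolding orbit_closure_def closure_of_def by blast
    have "b n = a (n + i)" if "n < m" for n
      using PiE_mem[OF i, of n] that by simp
    then show "\<exists>i. \<forall>n<m. b n = a (n + i)" by blast
  qed
next
  assume pre: "\<forall>m. \<exists>i. \<forall>n<m. b n = a (n + i)"
  have b\<Delta>: "b n \<in> \<Delta>" for n
    using pre[rule_format, of "Suc n"] assms by (metis lessI range_subsetD)
  show "b \<in> orbit_closure \<Delta> a"
    unfolding orbit_closure_def closure_of_def
  proof (intro CollectI conjI allI impI)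
    show "b \<in> topspace (product_topology (\<lambda>_. discrete_topology \<Delta>) UNIV)"
      using b\<Delta> by (simp add: PiE_iff)
    fix T assume T: "b \<in> T \<and> openin (product_topology (\<lambda>_. discrete_topology \<Delta>) UNIV) T"
    then obtain U where U: "finite {n. U n \<noteq> \<Delta>}" "b \<in> PiE UNIV U" "PiE UNIV U \<subseteq> T"
      unfolding openin_product_topology_alt by auto
    obtain m where m: "\<And>n. U n \<noteq> \<Delta> \<Longrightarrow> n < m"
      using U(1) finite_nat_set_iff_bounded by auto
    obtain i where i: "\<And>n. n < m \<Longrightarrow> b n = a (n + i)" using pre by blast
    have "a (n + i) \<in> U n" for n
    proof (cases "n < m")
      case True
      then show ?thesis using U(2) i[of n] by (metis PiE_mem UNIV_I)
    next
      case False
      then show ?thesis using m[of n] assms by auto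
    qed
    then have "(\<lambda>n. a (n + i)) \<in> T" using U(3) by auto
    then show "\<exists>y\<in>range (\<lambda>i n. a (n + i)). y \<in> T" by blast
  qed
qed

lemma ex1_lex_least_orbit_closure:
  fixes a :: "nat \<Rightarrow> 'd::linorder"
  assumes "finite \<Delta>" and a: "range a \<subseteq> \<Delta>"
  shows "\<exists>!b. lex_least (orbit_closure \<Delta> a) b"
proof -
  let ?S = "orbit_closure \<Delta> a"
  have S: "c \<in> ?S \<longleftrightarrow> (\<forall>m. \<exists>i. \<forall>n<m. c n = a (n + i))" for c
    by (rule orbit_closure_iff_prefixes[OF a])
  have S\<Delta>: "c n \<in> \<Delta>" if "c \<in> ?S" for c n
    using that by (auto simp: orbit_closure_def closure_of_def PiE_iff)
  define C where "C b n = {c n |c. c \<in> ?S \<and> (\<forall>i<n. c i = b i)}" for b :: "nat \<Rightarrow> 'd" and n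
  have fin: "finite (C b n)" for b n
    by (rule finite_subset[OF _ assms(1)]) (use S\<Delta> in \<open>auto simp: C_def\<close>)
  obtain b where b: "\<And>n. b n = Min (C b n)"
  proof -
    have "\<exists>b. \<forall>n. b n = Min (C b n)"
      by (rule dependent_wf_choice[where R = less_than and P = "\<lambda>b n r. r = Min (C b n)"])
         (auto simp: C_def)
    then show ?thesis using that by blast
  qed
  have pre: "\<exists>c\<in>?S. \<forall>i<n. c i = b i" for n
  proof (induction n)
    case 0
    have "a \<in> ?S" unfolding S by (intro allI exI[of _ 0]) simp
    then show ?case by blast
  next
    case (Suc n)
    then have "C b n \<noteq> {}" by (auto simp: C_def)
    then have "b n \<in> C b n" using Min_in[OF fin] b by metis
    then show ?case by (auto simp: C_def less_Suc_eq)
  qed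
  have bS: "b \<in> ?S" unfolding S
  proof
    fix m
    obtain c where c: "c \<in> ?S" "\<forall>i<m. c i = b i" using pre by blast
    then obtain i where "\<forall>n<m. c n = a (n + i)" using S by blast
    then show "\<exists>i. \<forall>n<m. b n = a (n + i)" using c(2) by auto
  qed
  have least: "b = c \<or> less_fun b c" if c: "c \<in> ?S" for c
  proof (cases "b = c")
    case False
    then have ex: "\<exists>n. b n \<noteq> c n" by auto
    define n where "n = (LEAST n. b n \<noteq> c n)"
    have n: "b n \<noteq> c n" "\<forall>i<n. b i = c i"
      using LeastI_ex[OF ex] not_less_Least unfolding n_def by blast+
    have "c n \<in> C b n" using c n(2) by (auto simp: C_def)
    then have "b n \<le> c n" using Min_le[OF fin] b by metis
    then have "less_fun b c" using n unfolding less_fun_def by (intro exI[of _ n]) auto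
    then show ?thesis ..
  qed simp
  show ?thesis
  proof (rule ex1I[of _ b])
    show "lex_least ?S b" using bS least by (simp add: lex_least_def)
    show "c = b" if "lex_least ?S c" for c
      using that bS least[of c] less_fun_asym[of b c] unfolding lex_least_def by blast
  qed
qed

end

theory Submission
  imports Defs
begin

text \<open>
  A sequence is \<open>k\<close>-automatic iff it lies in a finite set of sequences closed under the operations
  \<open>f \<mapsto> (n \<mapsto> f (k n + d))\<close>, \<open>d < k\<close>. The same finiteness condition makes sense for functions of
  several natural numbers, and there it is preserved by pointwise operations and by projection: a
  quantified variable \<open>x\<close> is split as \<open>k x' + s\<close>, so that the operations map a projection to a
  union of projections of members of the finite set. The prefixes of \<open>b\<close> are the lexicographically
  least factors of \<open>a\<close> of their length, so \<open>b n\<close> is the value \<open>a (i + n)\<close> for any \<open>i\<close> such that no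
  factor of length \<open>n + 1\<close> is smaller than the one at position \<open>i\<close>; this is a description by
  such operations.
\<close>

section \<open>Automatic sequences and finite kernels\<close>

text \<open>The \<open>k\<close>-kernel of \<open>a\<close> is the least closed set containing
  \<open>a\<close>. Any finite closed set serves as a witness, so the kernel never has to be
  computed exactly.\<close>

definition finite_kernel :: "nat \<Rightarrow> (nat \<Rightarrow> 'd) \<Rightarrow> bool" where
  "finite_kernel k a \<longleftrightarrow>
     (\<exists>A. finite A \<and> a \<in> A \<and> (\<forall>f\<in>A. \<forall>d<k. (\<lambda>n. f (k * n + d)) \<in> A))"

lemma base_rep_Nil: "base_rep k [] n \<longleftrightarrow> n = 0"
  by (auto simp: base_rep_def)

lemma base_rep_snoc:
  "base_rep k (w @ [d]) n \<longleftrightarrow> d < k \<and> (\<exists>m. base_rep k w m \<and> n = k * m + d)"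
  by (auto simp: base_rep_def)

lemma ex_base_rep:
  assumes "k \<ge> 2"
  shows "\<exists>w. base_rep k w n"
proof (induction n rule: less_induct)
  case (less n)
  show ?case
  proof (cases "n = 0")
    case True
    then show ?thesis using base_rep_Nil by blast
  next
    case False
    then have "n div k < n" using assms by simp
    then obtain w where "base_rep k w (n div k)" using less by blast
    then have "base_rep k (w @ [n mod k]) n"
      unfolding base_rep_snoc using assms by auto
    then show ?thesis by blast
  qed
qed

text \<open>The closed set consists of the sequences generated from the individual states. Since the
  least significant digit is read first, moving the start along \<open>d\<close> turns
  \<open>f n\<close> into \<open>f (k * n + d)\<close>.\<close>

lemma automatic_imp_finite_kernel:
  assumes "k \<ge> 2" and "automatic k \<Delta> a"
  shows "finite_kernel k a"
proof -
  obtain M :: "(nat, 'a) dfao" where M: "is_dfao k \<Delta> M" "generates k M a"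
    using assms(2) by (auto simp: automatic_def)
  define A where "A = {f. \<exists>q\<in>states M. generates k (M\<lparr>initial := q\<rparr>) f}"
  \<comment> \<open>As every number has a representation, a state generates at most one sequence; a
    state whose output depends on leading zeros generates none.\<close>
  have "A \<subseteq> (\<lambda>q n. tau M (foldl (delta M) q (rev (SOME w. base_rep k w n)))) ` states M"
  proof
    fix f assume "f \<in> A"
    then obtain q where q: "q \<in> states M" "generates k (M\<lparr>initial := q\<rparr>) f"
      by (auto simp: A_def)
    have "f n = tau M (foldl (delta M) q (rev (SOME w. base_rep k w n)))" for n
      using q(2) someI_ex[OF ex_base_rep[OF assms(1), of n]] by (auto simp: generates_def)
    then show "f \<in> (\<lambda>q n. tau M (foldl (delta M) q (rev (SOME w. base_rep k w n)))) ` states M"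
      using q(1) by (intro image_eqI[of _ _ q]) auto
  qed
  moreover have "finite (states M)" using M(1) by (simp add: is_dfao_def)
  ultimately have "finite A" by (meson finite_imageI finite_subset)
  moreover have "a \<in> A" using M by (auto simp: A_def is_dfao_def intro!: bexI[of _ "initial M"])
  moreover have "(\<lambda>n. f (k * n + d)) \<in> A" if f: "f \<in> A" and d: "d < k" for f d
  proof -
    obtain q where q: "q \<in> states M" "generates k (M\<lparr>initial := q\<rparr>) f"
      using f by (auto simp: A_def)
    have "f (k * n + d) = tau M (foldl (delta M) (delta M q d) (rev w))" if "base_rep k w n" for w n
    proof -
      have "base_rep k (w @ [d]) (k * n + d)" using that d by (auto simp: base_rep_snoc)
      then show ?thesis using q(2) by (auto simp: generates_def)
    qed
    then have "generates k (M\<lparr>initial := delta M q d\<rparr>) (\<lambda>n. f (k * n + d))"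
      by (simp add: generates_def)
    moreover have "delta M q d \<in> states M" using M(1) q(1) d by (simp add: is_dfao_def)
    ultimately show ?thesis by (auto simp: A_def)
  qed
  ultimately show ?thesis unfolding finite_kernel_def by blast
qed

text \<open>The sequences of the closed set are themselves the states. Once all digits are read, the
  number that remains is 0, so the output is \<open>f 0\<close>.\<close>

lemma finite_kernel_imp_automatic:
  assumes "finite_kernel k b" and "range b \<subseteq> \<Delta>"
  shows "automatic k \<Delta> b"
proof -
  obtain A where A: "finite A" "b \<in> A" "\<And>f d. f \<in> A \<Longrightarrow> d < k \<Longrightarrow> (\<lambda>n. f (k * n + d)) \<in> A"
    using assms(1) by (auto simp: finite_kernel_def)
  define M where "M = \<lparr>states = {f \<in> A. range f \<subseteq> \<Delta>}, initial = b,
    delta = (\<lambda>f d n. f (k * n + d)), tau = (\<lambda>f. f 0)\<rparr>"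
  have "is_dfao k \<Delta> M"
    using A assms(2) by (auto simp: is_dfao_def M_def)
  moreover have "f n = tau M (foldl (delta M) f (rev w))" if "base_rep k w n" for f n w
    using that
  proof (induction w arbitrary: f n rule: rev_induct)
    case Nil
    then show ?case by (simp add: base_rep_Nil M_def)
  next
    case (snoc d w)
    then obtain m where m: "base_rep k w m" "n = k * m + d" by (auto simp: base_rep_snoc)
    from snoc.IH[OF m(1), of "delta M f d"] m(2) show ?case by (simp add: M_def)
  qed
  then have "generates k M b" by (simp add: generates_def M_def)
  ultimately show ?thesis using automatic_if_dfao assms(2) by blast
qed

section \<open>Recognizable functions of several variables\<close>

text \<open>The arguments are given by a valuation \<open>\<rho>\<close> of variables; one digit of every variable is
  consumed at once.\<close>

definition recognizable :: "nat \<Rightarrow> (('v \<Rightarrow> nat) \<Rightarrow> 'y) \<Rightarrow> bool" where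
  "recognizable k f \<longleftrightarrow> (\<exists>S. finite S \<and> f \<in> S \<and>
     (\<forall>g\<in>S. \<forall>r. (\<forall>v. r v < k) \<longrightarrow> (\<lambda>\<rho>. g (\<lambda>v. k * \<rho> v + r v)) \<in> S))"

lemma recognizableI:
  assumes "finite S" "f \<in> S"
    and "\<And>g r. g \<in> S \<Longrightarrow> (\<And>v. r v < k) \<Longrightarrow> (\<lambda>\<rho>. g (\<lambda>v. k * \<rho> v + r v)) \<in> S"
  shows "recognizable k f"
  using assms unfolding recognizable_def by blast

lemma recognizableE:
  assumes "recognizable k f"
  obtains S where "finite S" "f \<in> S"
    "\<And>g r. g \<in> S \<Longrightarrow> (\<And>v. r v < k) \<Longrightarrow> (\<lambda>\<rho>. g (\<lambda>v. k * \<rho> v + r v)) \<in> S"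
  using assms unfolding recognizable_def by blast

section \<open>Closure under pointwise operations and projection\<close>

lemma recognizable_compose2:
  assumes "recognizable k f" and "recognizable k g"
  shows "recognizable k (\<lambda>\<rho>. h (f \<rho>) (g \<rho>))"
proof -
  obtain S where S: "finite S" "f \<in> S"
    "\<And>g r. g \<in> S \<Longrightarrow> (\<And>v. r v < k) \<Longrightarrow> (\<lambda>\<rho>. g (\<lambda>v. k * \<rho> v + r v)) \<in> S"
    using recognizableE[OF assms(1)] by blast
  obtain T where T: "finite T" "g \<in> T"
    "\<And>g r. g \<in> T \<Longrightarrow> (\<And>v. r v < k) \<Longrightarrow> (\<lambda>\<rho>. g (\<lambda>v. k * \<rho> v + r v)) \<in> T"
    using recognizableE[OF assms(2)] by blast
  let ?H = "\<lambda>(f, g) \<rho>. h (f \<rho>) (g \<rho>)"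
  show ?thesis
  proof (rule recognizableI[of "?H ` (S \<times> T)"])
    show "finite (?H ` (S \<times> T))" using S(1) T(1) by blast
    show "(\<lambda>\<rho>. h (f \<rho>) (g \<rho>)) \<in> ?H ` (S \<times> T)"
      using S(2) T(2) by (intro image_eqI[of _ _ "(f, g)"]) auto
    fix u and r :: "'a \<Rightarrow> nat" assume u: "u \<in> ?H ` (S \<times> T)" and r: "\<And>v. r v < k"
    obtain f' g' where u: "f' \<in> S" "g' \<in> T" "u = ?H (f', g')" using u by blast
    show "(\<lambda>\<rho>. u (\<lambda>v. k * \<rho> v + r v)) \<in> ?H ` (S \<times> T)"
      using S(3)[OF u(1), of r, OF r] T(3)[OF u(2), of r, OF r] u(3)
      by (intro image_eqI[of _ _ "(\<lambda>\<rho>. f' (\<lambda>v. k * \<rho> v + r v), \<lambda>\<rho>. g' (\<lambda>v. k * \<rho> v + r v))"]) auto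
  qed
qed

lemma recognizable_compose:
  assumes "recognizable k f"
  shows "recognizable k (\<lambda>\<rho>. h (f \<rho>))"
  using recognizable_compose2[OF assms assms, of "\<lambda>x _. h x"] .

text \<open>A subset construction: the states are unions of ranges over subsets of \<open>S\<close>.
  Collecting values instead of truth values covers quantifiers and also the final choice of a
  letter.\<close>

lemma recognizable_range:
  assumes "recognizable k f"
  shows "recognizable k (\<lambda>\<rho>. range (\<lambda>x. f (\<rho>(v := x))))"
proof -
  obtain S where S: "finite S" "f \<in> S"
    "\<And>g r. g \<in> S \<Longrightarrow> (\<And>v. r v < k) \<Longrightarrow> (\<lambda>\<rho>. g (\<lambda>v. k * \<rho> v + r v)) \<in> S"
    using recognizableE[OF assms] by blast
  define H where "H T \<rho> = (\<Union>g\<in>T. range (\<lambda>x. g (\<rho>(v := x))))"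
    for T :: "(('a \<Rightarrow> nat) \<Rightarrow> 'b) set" and \<rho>
  show ?thesis
  proof (rule recognizableI[of "H ` Pow S"])
    show "finite (H ` Pow S)" using S(1) by blast
    show "(\<lambda>\<rho>. range (\<lambda>x. f (\<rho>(v := x)))) \<in> H ` Pow S"
      using S(2) by (intro image_eqI[of _ _ "{f}"]) (auto simp: H_def fun_eq_iff)
    fix u and r :: "'a \<Rightarrow> nat" assume u: "u \<in> H ` Pow S" and r: "\<And>v. r v < k"
    obtain T where T: "T \<subseteq> S" "u = H T" using u by blast
    \<comment> \<open>\<open>D g s\<close> is \<open>g\<close> after reading the digit
      \<open>s\<close> for the projected variable and the digits \<open>r\<close> for all
      others.\<close>
    define D where "D g s \<rho> = g (\<lambda>w. k * \<rho> w + (r(v := s)) w)"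
      for g :: "('a \<Rightarrow> nat) \<Rightarrow> 'b" and s \<rho>
    define T' where "T' = {D g s |g s. g \<in> T \<and> s < k}"
    have "T' \<subseteq> S"
      using S(3)[of _ "r(v := _)"] T(1) r by (auto simp: T'_def D_def[abs_def])
    have D: "D g s (\<rho>(v := x)) = g ((\<lambda>w. k * \<rho> w + r w)(v := k * x + s))" for g s \<rho> x
      unfolding D_def by (rule arg_cong[of _ _ g]) auto
    have "u (\<lambda>w. k * \<rho> w + r w) = H T' \<rho>" for \<rho>
    proof (intro set_eqI iffI)
      fix y assume "y \<in> u (\<lambda>w. k * \<rho> w + r w)"
      then obtain g x where g: "g \<in> T" "y = g ((\<lambda>w. k * \<rho> w + r w)(v := x))"
        by (auto simp: T(2) H_def)
      have "y = D g (x mod k) (\<rho>(v := x div k))"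
        using g(2) unfolding D by simp
      \<comment> \<open>The bound \<open>r v < k\<close> forces \<open>k > 0\<close>, which makes
        \<open>x mod k\<close> a digit.\<close>
      moreover have "D g (x mod k) \<in> T'"
        using g(1) r[of v] by (auto simp: T'_def intro!: exI[of _ "x mod k"])
      ultimately show "y \<in> H T' \<rho>" by (auto simp: H_def)
    next
      fix y assume "y \<in> H T' \<rho>"
      then obtain g s x where "g \<in> T" "y = D g s (\<rho>(v := x))"
        by (auto simp: H_def T'_def)
      then show "y \<in> u (\<lambda>w. k * \<rho> w + r w)"
        unfolding D by (auto simp: T(2) H_def)
    qed
    then have "(\<lambda>\<rho>. u (\<lambda>w. k * \<rho> w + r w)) = H T'" by auto
    then show "(\<lambda>\<rho>. u (\<lambda>w. k * \<rho> w + r w)) \<in> H ` Pow S" using \<open>T' \<subseteq> S\<close> by blast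
  qed
qed

lemma recognizable_ex:
  assumes "recognizable k P"
  shows "recognizable k (\<lambda>\<rho>. \<exists>x. P (\<rho>(v := x)))"
proof -
  have "(\<lambda>\<rho>. \<exists>x. P (\<rho>(v := x))) = (\<lambda>\<rho>. True \<in> range (\<lambda>x. P (\<rho>(v := x))))"
    by (auto simp: fun_eq_iff)
  then show ?thesis
    using recognizable_compose[OF recognizable_range[OF assms, of v], of "\<lambda>V. True \<in> V"] by simp
qed

section \<open>Order and addition of variables\<close>

lemma digit_less_iff:
  fixes k m n p q :: nat
  assumes "p < k" "q < k"
  shows "k * m + p < k * n + q \<longleftrightarrow> (if p < q then m \<le> n else m < n)"
proof -
  consider "m < n" | "m = n" | "n < m" by linarith
  then show ?thesis
  proof cases
    case 1
    \<comment> \<open>Unequal leading parts contribute a difference of at least \<open>k\<close>,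
      which outweighs any last digits.\<close>
    then have "k * Suc m \<le> k * n" by (intro mult_le_mono2) simp
    then show ?thesis using 1 assms(1) by simp
  next
    case 3
    then have "k * Suc n \<le> k * m" by (intro mult_le_mono2) simp
    then show ?thesis using 3 assms(2) by simp
  qed simp
qed

text \<open>Two states suffice: a smaller digit of \<open>x\<close> leaves \<open>\<le>\<close> to
  be checked on the higher digits, a larger one leaves \<open><\<close>, and equal digits keep the
  relation.\<close>

lemma recognizable_less:
  fixes x y :: 'v
  shows "recognizable k (\<lambda>\<rho>. \<rho> x < \<rho> y)"
proof -
  let ?S = "{\<lambda>\<rho> :: 'v \<Rightarrow> nat. \<rho> x < \<rho> y, \<lambda>\<rho>. \<rho> x \<le> \<rho> y}"
  show ?thesis
  proof (rule recognizableI[of ?S])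
    fix g and r :: "'v \<Rightarrow> nat" assume g: "g \<in> ?S" and r: "\<And>v. r v < k"
    have lt: "k * m + r v < k * n + r w \<longleftrightarrow> (if r v < r w then m \<le> n else m < n)" for m n v w
      by (rule digit_less_iff[OF r r])
    have le: "k * m + r v \<le> k * n + r w \<longleftrightarrow> (if r w < r v then m < n else m \<le> n)" for m n v w
      using lt[of n w m v] by (auto simp: not_less[symmetric])
    consider "g = (\<lambda>\<rho>. \<rho> x < \<rho> y)" | "g = (\<lambda>\<rho>. \<rho> x \<le> \<rho> y)" using g by blast
    then show "(\<lambda>\<rho>. g (\<lambda>v. k * \<rho> v + r v)) \<in> ?S"
    proof cases
      case 1
      then show ?thesis by (cases "r x < r y") (simp_all add: lt)
    next
      case 2
      then show ?thesis by (cases "r y < r x") (simp_all add: le)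
    qed
  qed auto
qed

lemma recognizable_at_sum:
  fixes a :: "nat \<Rightarrow> 'd" and x y :: 'v
  assumes "finite_kernel k a"
  shows "recognizable k (\<lambda>\<rho>. a (\<rho> x + \<rho> y))"
proof -
  obtain A where A: "finite A" "a \<in> A" "\<And>f d. f \<in> A \<Longrightarrow> d < k \<Longrightarrow> (\<lambda>n. f (k * n + d)) \<in> A"
    using assms by (auto simp: finite_kernel_def)
  \<comment> \<open>\<open>c\<close> is the carry of the addition.\<close>
  define H where "H = (\<lambda>(f :: nat \<Rightarrow> 'd, c) \<rho>. f (\<rho> x + \<rho> y + c))"
  show ?thesis
  proof (rule recognizableI[of "H ` (A \<times> {0, 1})"])
    show "finite (H ` (A \<times> {0, 1}))" using A(1) by blast
    show "(\<lambda>\<rho>. a (\<rho> x + \<rho> y)) \<in> H ` (A \<times> {0, 1})"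
      using A(2) by (intro image_eqI[of _ _ "(a, 0)"]) (auto simp: H_def)
    fix g and r :: "'v \<Rightarrow> nat" assume g: "g \<in> H ` (A \<times> {0, 1})" and r: "\<And>v. r v < k"
    obtain f c where f: "f \<in> A" "c \<le> 1" "g = H (f, c)" using g by auto
    define c' d where "c' = (r x + r y + c) div k" and "d = (r x + r y + c) mod k"
    \<comment> \<open>Two digits and a carry add up to at most \<open>2 * (k - 1) + 1\<close>, so
      the new carry is again 0 or 1.\<close>
    have "r x + r y + c < 2 * k" using r[of x] r[of y] f(2) by linarith
    then have c': "c' \<in> {0, 1}"
      using less_mult_imp_div_less[of "r x + r y + c" 2 k] by (auto simp: c'_def)
    have "d < k" using r[of x] by (simp add: d_def)
    have sum: "r x + r y + c = k * c' + d" by (simp add: c'_def d_def)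
    have "k * m + r x + (k * n + r y) + c = k * (m + n + c') + d" for m n
      using sum by (simp add: algebra_simps)
    then have "(\<lambda>\<rho>. g (\<lambda>v. k * \<rho> v + r v)) = H (\<lambda>n. f (k * n + d), c')"
      by (simp add: f(3) H_def)
    then show "(\<lambda>\<rho>. g (\<lambda>v. k * \<rho> v + r v)) \<in> H ` (A \<times> {0, 1})"
      using A(3)[OF f(1) \<open>d < k\<close>] c' by blast
  qed
qed

text \<open>Members of \<open>S\<close> are evaluated at constant valuations; reading the same digit
  for all variables keeps a valuation constant.\<close>

lemma recognizable_imp_finite_kernel:
  assumes "recognizable k (\<lambda>\<rho>. b (\<rho> x))"
  shows "finite_kernel k b"
proof -
  obtain S where S: "finite S" "(\<lambda>\<rho>. b (\<rho> x)) \<in> S"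
    "\<And>g r. g \<in> S \<Longrightarrow> (\<And>v. r v < k) \<Longrightarrow> (\<lambda>\<rho>. g (\<lambda>v. k * \<rho> v + r v)) \<in> S"
    using recognizableE[OF assms] by blast
  let ?D = "\<lambda>g n. g (\<lambda>_. n)"
  have "finite (?D ` S)" "b \<in> ?D ` S" using S(1,2) by (auto intro: image_eqI[rotated])
  moreover have "(\<lambda>n. f (k * n + d)) \<in> ?D ` S" if f: "f \<in> ?D ` S" and d: "d < k" for f d
  proof -
    obtain g where g: "g \<in> S" "f = ?D g" using f by blast
    show ?thesis
      using S(3)[OF g(1), of "\<lambda>_. d"] d g(2)
      by (intro image_eqI[of _ _ "\<lambda>\<rho>. g (\<lambda>v. k * \<rho> v + d)"]) auto
  qed
  ultimately show ?thesis unfolding finite_kernel_def by blast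
qed

section \<open>Lexicographically least factors\<close>

text \<open>Lexicographic comparison of the factors of length \<open>n + 1\<close> at
  \<open>j\<close> and \<open>i\<close>. The negations stand in for \<open>\<le>\<close> and
  \<open>\<forall>\<close>, so that the body matches the closure lemmas directly.\<close>

definition smaller_factor :: "(nat \<Rightarrow> 'd::linorder) \<Rightarrow> nat \<Rightarrow> nat \<Rightarrow> nat \<Rightarrow> bool" where
  "smaller_factor a n j i \<longleftrightarrow>
     (\<exists>t. \<not> n < t \<and> a (j + t) < a (i + t) \<and> \<not> (\<exists>s<t. a (j + s) \<noteq> a (i + s)))"

text \<open>At a first difference one of the two factors would be smaller than the other. Hence the
  letter read at a minimal position does not depend on the position.\<close>

lemma least_factors_eq:
  assumes "\<And>j. \<not> smaller_factor a n j i" and "\<And>j. \<not> smaller_factor a n j i'"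
  shows "t \<le> n \<Longrightarrow> a (i + t) = a (i' + t)"
proof (induction t rule: less_induct)
  case (less t)
  then have eq: "\<forall>s<t. a (i + s) = a (i' + s)" by simp
  have "\<not> a (i + t) < a (i' + t)"
    using assms(2)[of i] less.prems eq unfolding smaller_factor_def by (metis not_less)
  moreover have "\<not> a (i' + t) < a (i + t)"
    using assms(1)[of i'] less.prems eq unfolding smaller_factor_def by (metis not_less)
  ultimately show ?case by simp
qed

lemma lex_least_prefix:
  assumes a: "range a \<subseteq> \<Delta>" and b: "lex_least (orbit_closure \<Delta> a) b"
  shows "\<exists>i. (\<forall>t\<le>n. b t = a (i + t)) \<and> (\<forall>j. \<not> smaller_factor a n j i)"
proof -
  have "b \<in> orbit_closure \<Delta> a" using b by (simp add: lex_least_def)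
  then obtain i where "\<forall>t<Suc n. b t = a (t + i)"
    using orbit_closure_iff_prefixes[OF a] by blast
  then have i: "b t = a (i + t)" if "t \<le> n" for t
    using that by (simp add: add.commute less_Suc_eq_le)
  moreover have "\<not> smaller_factor a n j i" for j
  proof
    assume "smaller_factor a n j i"
    then obtain t where t: "t \<le> n" "a (j + t) < a (i + t)" "\<forall>s<t. a (j + s) = a (i + s)"
      unfolding smaller_factor_def not_less by blast
    \<comment> \<open>A smaller factor at \<open>j\<close> would put the shift by \<open>j\<close>,
      a member of the orbit closure, below \<open>b\<close>.\<close>
    let ?c = "\<lambda>n. a (n + j)"
    have "?c \<in> orbit_closure \<Delta> a" unfolding orbit_closure_iff_prefixes[OF a] by blast
    then have "b = ?c \<or> less_fun b ?c" using b by (simp add: lex_least_def)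
    moreover have "less_fun ?c b"
      unfolding less_fun_def using t i by (intro exI[of _ t]) (auto simp: add.commute)
    ultimately show False using less_fun_asym less_fun_irrefl by metis
  qed
  ultimately show ?thesis by blast
qed

text \<open>Variables 0 to 4 stand for \<open>n\<close>, \<open>i\<close>, \<open>j\<close>,
  \<open>t\<close> and \<open>s\<close>, in this order; 4 and then 3 are projected away.\<close>

lemma recognizable_smaller_factor:
  assumes "finite_kernel k a"
  shows "recognizable k (\<lambda>\<rho>. smaller_factor a (\<rho> (0::nat)) (\<rho> 2) (\<rho> 1))"
proof -
  have "recognizable k (\<lambda>\<rho>. \<rho> (4::nat) < \<rho> 3 \<and> a (\<rho> 2 + \<rho> 4) \<noteq> a (\<rho> 1 + \<rho> 4))"
    by (intro recognizable_compose2[where h = "(\<and>)"] recognizable_less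
        recognizable_compose2[where h = "(\<noteq>)"] recognizable_at_sum assms)
  from recognizable_ex[OF this, of 4]
  have "recognizable k (\<lambda>\<rho>. \<exists>s<\<rho> (3::nat). a (\<rho> 2 + s) \<noteq> a (\<rho> 1 + s))"
    by simp
  then have "recognizable k (\<lambda>\<rho>. \<not> \<rho> (0::nat) < \<rho> 3 \<and> a (\<rho> 2 + \<rho> 3) < a (\<rho> 1 + \<rho> 3) \<and>
      \<not> (\<exists>s<\<rho> 3. a (\<rho> 2 + s) \<noteq> a (\<rho> 1 + s)))"
    by (intro recognizable_compose2[where h = "(\<and>)"] recognizable_less
        recognizable_compose[where h = Not]
        recognizable_compose2[where h = "(<)"] recognizable_at_sum assms)
  from recognizable_ex[OF this, of 3] show ?thesis
    by (simp add: smaller_factor_def)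
qed

theorem theorem5:
  fixes k :: nat and \<Delta> :: "'d::linorder set" and a b :: "nat \<Rightarrow> 'd"
  assumes "k \<ge> 2"
    and "finite \<Delta>"
    and "automatic k \<Delta> a"
    and "lex_least (orbit_closure \<Delta> a) b"
  shows "automatic k \<Delta> b"
proof (rule finite_kernel_imp_automatic)
  have a: "range a \<subseteq> \<Delta>" using assms(3) by (simp add: automatic_def)
  note prefix = lex_least_prefix[OF a assms(4)]
  show "range b \<subseteq> \<Delta>"
  proof clarify
    fix n
    obtain i where "b n = a (i + n)" using prefix[of n] by blast
    then show "b n \<in> \<Delta>" using a by auto
  qed
  have kernel: "finite_kernel k a" using automatic_imp_finite_kernel assms(1,3) .
  \<comment> \<open>\<open>None\<close> marks positions whose factor of length \<open>n + 1\<close>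
    is not least, so the range over all positions contains exactly one \<open>Some\<close> value,
    namely \<open>Some (b n)\<close>.\<close>
  define candidate where
    "candidate n i = (if \<exists>j. smaller_factor a n j i then None else Some (a (i + n)))" for n i
  have "recognizable k (\<lambda>\<rho>. \<exists>j. smaller_factor a (\<rho> (0::nat)) j (\<rho> 1))"
    using recognizable_ex[OF recognizable_smaller_factor[OF kernel], of 2] by simp
  then have "recognizable k (\<lambda>\<rho>. candidate (\<rho> (0::nat)) (\<rho> 1))"
    unfolding candidate_def
    by (rule recognizable_compose2[where h = "\<lambda>p d. if p then None else Some d"])
       (rule recognizable_at_sum[OF kernel])
  from recognizable_range[OF this, of 1]
  have "recognizable k (\<lambda>\<rho>. range (candidate (\<rho> (0::nat))))"
    by simp
  \<comment> \<open>Extracting the letter is a pointwise operation on the set-valued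
    function.\<close>
  then have "recognizable k (\<lambda>\<rho>. THE d. Some d \<in> range (candidate (\<rho> (0::nat))))"
    by (rule recognizable_compose)
  moreover have "(THE d. Some d \<in> range (candidate n)) = b n" for n
  proof (rule the_equality)
    obtain i where i: "\<forall>t\<le>n. b t = a (i + t)" "\<And>j. \<not> smaller_factor a n j i"
      using prefix[of n] by blast
    then have "candidate n i = Some (b n)" by (simp add: candidate_def)
    then show "Some (b n) \<in> range (candidate n)" by (metis rangeI)
    fix d assume "Some d \<in> range (candidate n)"
    then obtain i' where i': "d = a (i' + n)" "\<And>j. \<not> smaller_factor a n j i'"
      by (auto simp: candidate_def split: if_splits)
    then show "d = b n" using least_factors_eq[OF i'(2) i(2), of n] i(1) by simp
  qed
  ultimately have "recognizable k (\<lambda>\<rho>. b (\<rho> (0::nat)))" by simp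
  then show "finite_kernel k b" by (rule recognizable_imp_finite_kernel)
qed

end
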